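(* For all real $\alpha\ge 2$ and all integers $n\ge 3$, the best constant $c_n(\alpha)$ in the Markov inequality $\|p'\|_{w_\alpha}\le c_n(\alpha)\|p\|_{w_\alpha}$, $p\in\mathcal{P}_n$, satisfies $$\frac{(n+1)(n+\alpha+4)}{2(\alpha+1)(\alpha+8)}\le [c_n(\alpha)]^2\le \frac{4(n+1)(n+\alpha+4)}{(\alpha+1)(\alpha+8)}.$$
   Context: For real $\alpha>-1$ let $w_\alpha(t)=t^\alpha e^{-t}$, $t>0$, be the Laguerre weight and $\|f\|_{w_\alpha}=\left(\int_0^\infty |f(x)|^2 w_\alpha(x)\,dx\right)^{1/2}$. $\mathcal{P}_n$ is the set of algebraic polynomials (real coefficients) of degree at most $n$. The best Markov constant is $c_n(\alpha)=\sup_{p\in\mathcal{P}_n,\,p\ne 0}\|p'\|_{w_\alpha}/\|p\|_{w_\alpha}$. *)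

theory Defs
  imports "HOL-Analysis.Analysis" "HOL-Computational_Algebra.Polynomial"
begin

definition laguerre_weight :: "real \<Rightarrow> real \<Rightarrow> real" where
  "laguerre_weight \<alpha> t = t powr \<alpha> * exp (- t)"

definition laguerre_norm :: "real \<Rightarrow> (real \<Rightarrow> real) \<Rightarrow> real" where
  "laguerre_norm \<alpha> f =
     sqrt (LINT x:{0<..}|lborel. \<bar>f x\<bar>\<^sup>2 * laguerre_weight \<alpha> x)"

definition polys_upto :: "nat \<Rightarrow> real poly set" where
  "polys_upto n = {p. degree p \<le> n}"

(* For \<alpha> > -1 every integral below converges, the denominators are positive, and the set of
   quotients is nonempty and bounded above (\<P>\<^sub>n is finite-dimensional), so the real-valued
   supremum is the mathematical one. *)
definition markov_const :: "nat \<Rightarrow> real \<Rightarrow> real" where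
  "markov_const n \<alpha> =
     (SUP p \<in> polys_upto n - {0}.
        laguerre_norm \<alpha> (poly (pderiv p)) / laguerre_norm \<alpha> (poly p))"

end

theory Submission
  imports Defs
begin

text \<open>
  The Laguerre polynomials \<open>L\<^sub>k\<close> for the parameter \<open>\<alpha>\<close> are orthogonal with respect to the weight, their square norms
  \<open>h\<^sub>k\<close> satisfy \<open>h\<^sub>k\<^sub>+\<^sub>1 / h\<^sub>k = (k + 1 + \<alpha>) / (k + 1)\<close> (lemma \<open>laguerre_sqnorm_Suc\<close>), and
  \<open>L\<^sub>k' = - (L\<^sub>0 + \<dots> + L\<^sub>k\<^sub>-\<^sub>1)\<close> (lemma \<open>pderiv_laguerre\<close>). Expand \<open>p\<close> as the sum of \<open>a\<^sub>k L\<^sub>k\<close> over \<open>k \<le> n\<close>, and let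
  \<open>A\<^sub>j\<close> be the sum of the \<open>a\<^sub>k\<close> with \<open>k > j\<close>. Then the squared Markov constant is the best \<open>C\<close> in the weighted
  discrete Hardy inequality
  \<open>\<Sum>j<n. h\<^sub>j A\<^sub>j\<^sup>2 \<le> C (\<Sum>j<n. h\<^sub>j\<^sub>+\<^sub>1 (A\<^sub>j - A\<^sub>j\<^sub>+\<^sub>1)\<^sup>2)\<close>, where \<open>A\<^sub>n = 0\<close>.

  For the lower bound it suffices to try all \<open>a\<^sub>k = 1\<close>. The quotient is then exactly
  \<open>n (2n + \<alpha> + 1) / ((\<alpha> + 2) (\<alpha> + 3))\<close> (lemma \<open>laguerre_sum_quotient\<close>).

  For the upper bound, the reciprocal of the best \<open>C\<close> is, after rescaling, the least eigenvalue of a Jacobi matrix, and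
  a number \<open>\<mu>\<close> does not exceed it once there is a positive supersolution for \<open>\<mu>\<close>. In terms of the ratios \<open>1 - t\<^sub>j\<close> of consecutive terms this means
  \<open>\<mu> + t\<^sub>j\<^sub>-\<^sub>1 / (1 - t\<^sub>j\<^sub>-\<^sub>1) \<le> (h\<^sub>j\<^sub>+\<^sub>1 / h\<^sub>j) t\<^sub>j\<close>, a discrete Riccati inequality (lemma \<open>discrete_hardy\<close>). For
  \<open>\<mu> = (\<alpha> + 1) (\<alpha> + 8) / (4 (n + 1) (n + \<alpha> + 4))\<close> an explicit rational function of \<open>j\<close> solves it for all \<open>\<alpha> \<ge> 2\<close> and
  all \<open>n\<close> at once (lemma \<open>trial_riccati\<close>). The verification is the nonnegativity of a polynomial in three variables
  which, in suitable variables, has only nonnegative coefficients.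
\<close>

section \<open>Integration against the Laguerre weight\<close>

definition weighted_integral :: "real \<Rightarrow> real poly \<Rightarrow> real" where
  "weighted_integral \<alpha> p = (LINT t:{0<..}|lborel. poly p t * laguerre_weight \<alpha> t)"

lemma laguerre_moment:
  assumes "\<alpha> > -1"
  shows "set_integrable lborel {0<..} (\<lambda>t. t ^ k * laguerre_weight \<alpha> t)"
    and "(LINT t:{0<..}|lborel. t ^ k * laguerre_weight \<alpha> t) = Gamma (\<alpha> + 1 + real k)"
proof -
  let ?s = "\<alpha> + 1 + real k"
  let ?f = "\<lambda>t::real. indicator {0..} t * t powr (?s - 1) / exp t"
  have s: "?s > 0" using assms by linarith
  have "has_bochner_integral lborel ?f (Gamma ?s)"
    by (rule has_bochner_integral_nn_integral)
       (use s in \<open>simp_all add: Gamma_conv_nn_integral_real less_imp_le Gamma_real_pos\<close>)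
  also have "?f = (\<lambda>t. indicator {0<..} t *\<^sub>R (t ^ k * laguerre_weight \<alpha> t))"
  proof
    fix t :: real
    consider "t < 0" | "t = 0" | "t > 0" by linarith
    then show "?f t = indicator {0<..} t *\<^sub>R (t ^ k * laguerre_weight \<alpha> t)"
    proof cases
      case 3
      have "t powr (\<alpha> + real k) = t powr \<alpha> * t ^ k"
        using 3 by (simp add: powr_add powr_realpow)
      with 3 show ?thesis by (simp add: laguerre_weight_def exp_minus field_simps)
    qed simp_all
  qed
  finally have *: "has_bochner_integral lborel
      (\<lambda>t. indicator {0<..} t *\<^sub>R (t ^ k * laguerre_weight \<alpha> t)) (Gamma ?s)" .
  show "set_integrable lborel {0<..} (\<lambda>t. t ^ k * laguerre_weight \<alpha> t)"
    unfolding set_integrable_def using * by (rule integrable.intros)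
  show "(LINT t:{0<..}|lborel. t ^ k * laguerre_weight \<alpha> t) = Gamma ?s"
    unfolding set_lebesgue_integral_def using * by (rule has_bochner_integral_integral_eq)
qed

lemma set_integrable_poly_laguerre_weight:
  assumes "\<alpha> > -1"
  shows "set_integrable lborel {0<..} (\<lambda>t. poly p t * laguerre_weight \<alpha> t)"
proof -
  have "set_integrable lborel {0<..}
          (\<lambda>t. \<Sum>k\<in>{..degree p}. coeff p k * (t ^ k * laguerre_weight \<alpha> t))"
    unfolding set_integrable_def scaleR_sum_right
    using laguerre_moment(1)[OF assms, unfolded set_integrable_def]
    by (intro Bochner_Integration.integrable_sum) (simp add: mult.left_commute)
  then show ?thesis
    by (simp add: poly_altdef sum_distrib_right mult.assoc)
qed

lemma weighted_integral_add:
  assumes "\<alpha> > -1"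
  shows "weighted_integral \<alpha> (p + q) = weighted_integral \<alpha> p + weighted_integral \<alpha> q"
  unfolding weighted_integral_def poly_add distrib_right
  by (rule set_integral_add(2)) (rule set_integrable_poly_laguerre_weight[OF assms])+

lemma weighted_integral_smult:
  "weighted_integral \<alpha> (smult c p) = c * weighted_integral \<alpha> p"
  unfolding weighted_integral_def poly_smult mult.assoc by (rule set_integral_mult_right)

lemma weighted_integral_diff:
  assumes "\<alpha> > -1"
  shows "weighted_integral \<alpha> (p - q) = weighted_integral \<alpha> p - weighted_integral \<alpha> q"
  using weighted_integral_add[OF assms, of "p - q" q] by simp

lemma weighted_integral_sum:
  assumes "\<alpha> > -1"
  shows "weighted_integral \<alpha> (\<Sum>i\<in>A. f i) = (\<Sum>i\<in>A. weighted_integral \<alpha> (f i))"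
proof (induction A rule: infinite_finite_induct)
  case (insert x A)
  then show ?case by (simp add: weighted_integral_add[OF assms])
qed (use weighted_integral_smult[of \<alpha> 0 0] in auto)

lemma weighted_integral_1_pos:
  assumes "\<alpha> > -1"
  shows "weighted_integral \<alpha> 1 > 0"
  using laguerre_moment(2)[OF assms, of 0] assms
  by (simp add: weighted_integral_def Gamma_real_pos)

text \<open>
  The integral of \<open>(t\<^sup>\<alpha>\<^sup>+\<^sup>1 e\<^sup>-\<^sup>t p)'\<close> over the half line vanishes. On monomials this is the functional
  equation of the Gamma function, and both sides are linear in \<open>p\<close>.
\<close>

lemma weighted_integral_by_parts:
  assumes "\<alpha> > -1"
  shows "weighted_integral \<alpha> ([:0, 1:] * pderiv p) = weighted_integral \<alpha> ([:- \<alpha> - 1, 1:] * p)"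
proof -
  have mono: "weighted_integral \<alpha> (monom 1 k) = Gamma (\<alpha> + 1 + real k)" for k
    using laguerre_moment(2)[OF assms, of k] by (simp add: weighted_integral_def poly_monom)
  have gamma: "Gamma (\<alpha> + 1 + real (Suc k)) = (\<alpha> + 1 + real k) * Gamma (\<alpha> + 1 + real k)" for k
  proof -
    have "\<alpha> + 1 + real k \<notin> \<int>\<^sub>\<le>\<^sub>0" using assms by (auto dest: nonpos_Ints_nonpos)
    then show ?thesis using Gamma_plus1[of "\<alpha> + 1 + real k"] by (simp add: add_ac)
  qed
  have step: "weighted_integral \<alpha> ([:0, 1:] * pderiv (monom 1 k))
      = weighted_integral \<alpha> ([:- \<alpha> - 1, 1:] * monom 1 k)" for k
  proof -
    have "[:0, 1:] * pderiv (monom 1 k) = smult (real k) (monom 1 k)"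
      by (cases k) (simp_all add: pderiv_monom flip: monom_Suc, simp_all add: smult_monom monom_0)
    moreover have "[:- \<alpha> - 1, 1:] * monom 1 k = monom 1 (Suc k) - smult (\<alpha> + 1) (monom 1 k)"
      by (simp add: monom_Suc algebra_simps flip: smult_add_left)
    ultimately show ?thesis
      by (simp only: weighted_integral_diff[OF assms] weighted_integral_smult mono gamma)
         (simp add: algebra_simps)
  qed
  \<comment> \<open>With an anonymous index set the expansion can be substituted for \<open>p\<close> without rewriting \<open>degree p\<close>.\<close>
  have "p = (\<Sum>k\<le>degree p. smult (coeff p k) (monom 1 k))"
    by (simp add: smult_monom flip: poly_as_sum_of_monoms)
  then obtain A :: "nat set" where p: "p = (\<Sum>k\<in>A. smult (coeff p k) (monom 1 k))" by blast
  have pderiv_sum: "pderiv (sum f A) = (\<Sum>k\<in>A. pderiv (f k))" for f :: "nat \<Rightarrow> real poly"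
    using higher_pderiv_sum[of 1 f A] by simp
  show ?thesis
    by (subst (1 2) p, unfold pderiv_sum pderiv_smult sum_distrib_left mult_smult_right,
        simp only: weighted_integral_sum[OF assms] weighted_integral_smult step)
qed

lemma laguerre_norm_poly:
  "laguerre_norm \<alpha> (poly p) = sqrt (weighted_integral \<alpha> (p * p))"
  by (simp add: laguerre_norm_def weighted_integral_def power2_eq_square)

section \<open>Laguerre polynomials\<close>

text \<open>
  The recursion is the raising relation of the Laguerre polynomials \<open>L\<^sub>k\<close>. Unlike the coefficient formula
  it yields the differential relations below by a short simultaneous induction.
\<close>

fun laguerre :: "real \<Rightarrow> nat \<Rightarrow> real poly" where
  "laguerre \<alpha> 0 = 1"
| "laguerre \<alpha> (Suc k) = smult (1 / (real k + 1))
     ([:0, 1:] * pderiv (laguerre \<alpha> k) + [:real k + 1 + \<alpha>, -1:] * laguerre \<alpha> k)"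

declare laguerre.simps(2) [simp del]

lemma laguerre_Suc:
  "of_nat (Suc k) * laguerre \<alpha> (Suc k) =
     [:0, 1:] * pderiv (laguerre \<alpha> k) + (of_nat (Suc k) + [:\<alpha>:] - [:0, 1:]) * laguerre \<alpha> k"
proof -
  have "of_nat (Suc k) + [:\<alpha>:] - [:0, 1:] = [:real k + 1 + \<alpha>, -1:]"
    by (simp add: of_nat_poly algebra_simps)
  then show ?thesis
    using of_nat_neq_0[of k, where ?'a = real]
    by (simp add: laguerre.simps(2) of_nat_poly add_ac)
qed

text \<open>
  The two relations feed each other: the differential equation for \<open>L\<^sub>k\<close>, inserted into the derivative of
  the recursion, gives \<open>L\<^sub>k\<^sub>+\<^sub>1' = L\<^sub>k' - L\<^sub>k\<close>, and this in turn turns the recursion into the differential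
  equation for \<open>L\<^sub>k\<^sub>+\<^sub>1\<close>.
\<close>

lemma laguerre_ode:
  "[:0, 1:] * pderiv (pderiv (laguerre \<alpha> k)) + ([:\<alpha>:] + 1 - [:0, 1:]) * pderiv (laguerre \<alpha> k)
     + of_nat k * laguerre \<alpha> k = 0"
  and pderiv_laguerre_Suc:
  "pderiv (laguerre \<alpha> (Suc k)) = pderiv (laguerre \<alpha> k) - laguerre \<alpha> k"
proof -
  have "[:0, 1:] * pderiv (pderiv (laguerre \<alpha> k)) + ([:\<alpha>:] + 1 - [:0, 1:]) * pderiv (laguerre \<alpha> k)
     + of_nat k * laguerre \<alpha> k = 0 \<and>
    pderiv (laguerre \<alpha> (Suc k)) = pderiv (laguerre \<alpha> k) - laguerre \<alpha> k"
    (is "?ode k \<and> ?diff k")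
  proof (induction k)
    have diff: "?diff k" if "?ode k" for k
    proof -
      have X: "pderiv [:0, 1:] = (1 :: real poly)" "pderiv [:\<alpha>:] = 0"
        by (simp_all add: pderiv_pCons)
      have "of_nat (Suc k) * pderiv (laguerre \<alpha> (Suc k)) =
          pderiv (of_nat (Suc k) * laguerre \<alpha> (Suc k))"
        by (simp add: pderiv_mult del: of_nat_Suc)
      also have "\<dots> = of_nat (Suc k) * (pderiv (laguerre \<alpha> k) - laguerre \<alpha> k)"
        using that unfolding laguerre_Suc
        unfolding pderiv_add pderiv_mult pderiv_diff pderiv_of_nat pderiv_1 X of_nat_Suc by algebra
      finally show ?thesis by (metis mult_left_cancel of_nat_neq_0)
    qed
    case 0
    show ?case using diff[of 0] by (simp add: pderiv_pCons)
    case (Suc k)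
    have "?ode (Suc k)"
    proof -
      let ?L = "laguerre \<alpha> k" and ?M = "laguerre \<alpha> (Suc k)"
      have ode: "?ode k" and d: "pderiv ?M = pderiv ?L - ?L" using Suc by blast+
      show ?thesis
        using ode unfolding d pderiv_diff laguerre_Suc unfolding of_nat_Suc by algebra
    qed
    then show ?case using diff by blast
  qed
  then show "[:0, 1:] * pderiv (pderiv (laguerre \<alpha> k)) + ([:\<alpha>:] + 1 - [:0, 1:]) * pderiv (laguerre \<alpha> k)
     + of_nat k * laguerre \<alpha> k = 0"
    and "pderiv (laguerre \<alpha> (Suc k)) = pderiv (laguerre \<alpha> k) - laguerre \<alpha> k"
    by blast+
qed

text \<open>
  Telescoping. In the Laguerre basis, differentiation is therefore a summation operator,
  which is what turns Markov's inequality into Hardy's.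
\<close>

lemma pderiv_laguerre: "pderiv (laguerre \<alpha> k) = - (\<Sum>j<k. laguerre \<alpha> j)"
  by (induction k) (simp_all add: pderiv_laguerre_Suc)

lemma x_pderiv_laguerre:
  "[:0, 1:] * pderiv (laguerre \<alpha> (Suc k)) =
     of_nat (Suc k) * laguerre \<alpha> (Suc k) - (of_nat (Suc k) + [:\<alpha>:]) * laguerre \<alpha> k"
  unfolding laguerre_Suc pderiv_laguerre_Suc by algebra

lemma degree_laguerre: "degree (laguerre \<alpha> k) = k"
proof (induction k)
  case (Suc k)
  have nz: "laguerre \<alpha> k \<noteq> 0" using Suc by (cases k) auto
  have "degree ([:0, 1:] * pderiv (laguerre \<alpha> k)) \<le> k"
  proof (cases k)
    case 0 then show ?thesis by simp
  next
    case (Suc l)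
    have "degree ([:0, 1:] * pderiv (laguerre \<alpha> k)) \<le> degree [:0, 1::real:] + degree (pderiv (laguerre \<alpha> k))"
      by (rule degree_mult_le)
    then show ?thesis using Suc \<open>degree (laguerre \<alpha> k) = k\<close> by (simp add: degree_pderiv)
  qed
  moreover have "degree ([:real k + 1 + \<alpha>, -1:] * laguerre \<alpha> k) = Suc k"
    using nz Suc by (subst degree_mult_eq) simp_all
  ultimately have "degree ([:0, 1:] * pderiv (laguerre \<alpha> k) + [:real k + 1 + \<alpha>, -1:] * laguerre \<alpha> k) = Suc k"
    by (subst degree_add_eq_right) simp_all
  then show ?case by (simp add: laguerre.simps(2) add_eq_0_iff)
qed simp

text \<open>
  The operator \<open>p \<mapsto> x p'' + (\<alpha> + 1 - x) p'\<close> is minus the self-adjoint operator of the Dirichlet form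
  \<open>\<integral> x p' q'\<close>, and \<open>L\<^sub>k\<close> is an eigenfunction of it with eigenvalue \<open>-k\<close>. Both the orthogonality and the norms
  of the \<open>L\<^sub>k\<close> follow.
\<close>

lemma laguerre_orthogonal_derivs:
  assumes "\<alpha> > -1"
  shows "weighted_integral \<alpha> ([:0, 1:] * pderiv (laguerre \<alpha> k) * pderiv q) =
    real k * weighted_integral \<alpha> (laguerre \<alpha> k * q)"
proof -
  let ?L = "laguerre \<alpha> k"
  have "weighted_integral \<alpha> ([:0, 1:] * pderiv (pderiv ?L * q)) =
      weighted_integral \<alpha> ([:- \<alpha> - 1, 1:] * (pderiv ?L * q))"
    by (rule weighted_integral_by_parts[OF assms])
  moreover have "[:0, 1:] * pderiv (pderiv ?L * q) =
     [:0, 1:] * pderiv ?L * pderiv q + [:- \<alpha> - 1, 1:] * (pderiv ?L * q) - of_nat k * (?L * q)"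
  proof -
    have "[:- \<alpha> - 1, 1:] = [:0, 1:] - 1 - [:\<alpha>:]" by (simp add: one_pCons)
    then show ?thesis unfolding pderiv_mult using laguerre_ode[of \<alpha> k] by algebra
  qed
  moreover have "of_nat k * (?L * q) = smult (real k) (?L * q)"
    by (simp add: of_nat_poly)
  ultimately show ?thesis
    by (simp add: weighted_integral_diff[OF assms] weighted_integral_add[OF assms] weighted_integral_smult)
qed

lemma laguerre_orthogonal:
  assumes "\<alpha> > -1" "j \<noteq> k"
  shows "weighted_integral \<alpha> (laguerre \<alpha> j * laguerre \<alpha> k) = 0"
proof -
  have "real j * weighted_integral \<alpha> (laguerre \<alpha> j * laguerre \<alpha> k)
      = real k * weighted_integral \<alpha> (laguerre \<alpha> j * laguerre \<alpha> k)"
    using laguerre_orthogonal_derivs[OF assms(1), of j "laguerre \<alpha> k"]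
      laguerre_orthogonal_derivs[OF assms(1), of k "laguerre \<alpha> j"]
    by (simp add: mult_ac)
  then show ?thesis using assms(2) by simp
qed

definition laguerre_sqnorm :: "real \<Rightarrow> nat \<Rightarrow> real" where
  "laguerre_sqnorm \<alpha> k = weighted_integral \<alpha> (laguerre \<alpha> k * laguerre \<alpha> k)"

lemma weighted_integral_laguerre_sum:
  assumes "\<alpha> > -1" "finite A"
  shows "weighted_integral \<alpha> ((\<Sum>k\<in>A. smult (a k) (laguerre \<alpha> k)) * (\<Sum>k\<in>A. smult (b k) (laguerre \<alpha> k)))
    = (\<Sum>k\<in>A. a k * b k * laguerre_sqnorm \<alpha> k)"
proof -
  have "weighted_integral \<alpha> ((\<Sum>k\<in>A. smult (a k) (laguerre \<alpha> k)) * (\<Sum>k\<in>A. smult (b k) (laguerre \<alpha> k)))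
     = (\<Sum>j\<in>A. \<Sum>k\<in>A. a j * b k * weighted_integral \<alpha> (laguerre \<alpha> j * laguerre \<alpha> k))"
    unfolding sum_product by (simp add: weighted_integral_sum[OF assms(1)] weighted_integral_smult mult_ac)
  also have "\<dots> = (\<Sum>j\<in>A. \<Sum>k\<in>A. if k = j then a j * b j * laguerre_sqnorm \<alpha> j else 0)"
    by (intro sum.cong refl) (auto simp: laguerre_sqnorm_def laguerre_orthogonal[OF assms(1)])
  finally show ?thesis using assms(2) by simp
qed

text \<open>
  The Dirichlet form at \<open>L\<^sub>k\<^sub>+\<^sub>1\<close> is computed in two ways: by the eigenvalue relation it is
  \<open>k + 1\<close> times the square norm of \<open>L\<^sub>k\<^sub>+\<^sub>1\<close>, and by expanding \<open>x L\<^sub>k\<^sub>+\<^sub>1'\<close> and \<open>L\<^sub>k\<^sub>+\<^sub>1'\<close> in Laguerre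
  polynomials, where only \<open>L\<^sub>k\<close> is common to both, it is \<open>k + 1 + \<alpha>\<close> times that of \<open>L\<^sub>k\<close>.
\<close>

lemma laguerre_sqnorm_Suc:
  assumes "\<alpha> > -1"
  shows "(real k + 1) * laguerre_sqnorm \<alpha> (Suc k) = (real k + 1 + \<alpha>) * laguerre_sqnorm \<alpha> k"
proof -
  let ?L = "laguerre \<alpha>" and ?I = "weighted_integral \<alpha>"
  have orth: "?I (?L i * (\<Sum>j<Suc k. ?L j)) = (if i = k then laguerre_sqnorm \<alpha> k else 0)"
    if "i \<ge> k" for i
  proof -
    have "?I (?L i * (\<Sum>j<Suc k. ?L j)) = (\<Sum>j<Suc k. ?I (?L i * ?L j))"
      unfolding sum_distrib_left by (rule weighted_integral_sum[OF assms])
    also have "\<dots> = (\<Sum>j<Suc k. if j = i then laguerre_sqnorm \<alpha> i else 0)"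
      by (intro sum.cong refl) (auto simp: laguerre_sqnorm_def laguerre_orthogonal[OF assms])
    finally show ?thesis using that by auto
  qed
  have "real (Suc k) * laguerre_sqnorm \<alpha> (Suc k)
      = ?I ([:0, 1:] * pderiv (?L (Suc k)) * pderiv (?L (Suc k)))"
    unfolding laguerre_sqnorm_def by (rule laguerre_orthogonal_derivs[OF assms, symmetric])
  also have "[:0, 1:] * pderiv (?L (Suc k)) * pderiv (?L (Suc k)) =
      smult (real (Suc k) + \<alpha>) (?L k * (\<Sum>j<Suc k. ?L j))
      - smult (real (Suc k)) (?L (Suc k) * (\<Sum>j<Suc k. ?L j))"
  proof -
    have scalars: "smult (real (Suc k) + \<alpha>) p = (of_nat (Suc k) + [:\<alpha>:]) * p"
      "smult (real (Suc k)) p = of_nat (Suc k) * p" for p :: "real poly"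
      by (simp_all add: of_nat_poly del: of_nat_Suc)
    show ?thesis
      using x_pderiv_laguerre[of \<alpha> k] unfolding pderiv_laguerre[of \<alpha> "Suc k"] scalars by algebra
  qed
  also have "?I \<dots> = (real (Suc k) + \<alpha>) * laguerre_sqnorm \<alpha> k"
    by (simp only: weighted_integral_diff[OF assms] weighted_integral_smult orth) (simp add: orth)
  finally show ?thesis by (simp add: add_ac)
qed

lemma laguerre_sqnorm_pos:
  assumes "\<alpha> > -1"
  shows "laguerre_sqnorm \<alpha> k > 0"
proof (induction k)
  case 0
  show ?case using weighted_integral_1_pos[OF assms] by (simp add: laguerre_sqnorm_def)
next
  case (Suc k)
  have "(real k + 1 + \<alpha>) * laguerre_sqnorm \<alpha> k > 0"
    using Suc assms by (intro mult_pos_pos) auto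
  then show ?case
    by (metis laguerre_sqnorm_Suc[OF assms] add.commute of_nat_Suc of_nat_0_less_iff zero_less_Suc zero_less_mult_pos)
qed

lemma laguerre_expansion:
  assumes "degree p \<le> n"
  obtains a where "p = (\<Sum>k\<le>n. smult (a k) (laguerre \<alpha> k))"
proof -
  have "\<exists>a. p = (\<Sum>k\<le>n. smult (a k) (laguerre \<alpha> k))"
    using assms
  proof (induction n arbitrary: p)
    case 0
    then obtain c where "p = [:c:]" by (metis degree_eq_zeroE le_zero_eq)
    then show ?case by (intro exI[of _ "\<lambda>_. c"]) simp
  next
    case (Suc n)
    let ?L = "laguerre \<alpha> (Suc n)"
    let ?c = "coeff p (Suc n) / coeff ?L (Suc n)"
    have L: "coeff ?L (Suc n) \<noteq> 0"
      using degree_laguerre[of \<alpha> "Suc n"] by (metis degree_0 leading_coeff_0_iff nat.distinct(1))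
    have "degree (p - smult ?c ?L) \<le> n"
    proof (rule degree_le, intro allI impI)
      fix i assume "n < i"
      then consider "i = Suc n" | "i > Suc n" by linarith
      then show "coeff (p - smult ?c ?L) i = 0"
        by cases (use L Suc.prems in \<open>simp_all add: coeff_eq_0 degree_laguerre\<close>)
    qed
    then obtain a where "p - smult ?c ?L = (\<Sum>k\<le>n. smult (a k) (laguerre \<alpha> k))"
      using Suc.IH by blast
    then have "p = (\<Sum>k\<le>Suc n. smult ((a(Suc n := ?c)) k) (laguerre \<alpha> k))"
      by (simp add: algebra_simps)
    then show ?case by blast
  qed
  then show thesis using that by blast
qed

lemma pderiv_laguerre_expansion:
  "pderiv (\<Sum>k\<le>n. smult (a k) (laguerre \<alpha> k)) =
     (\<Sum>j<n. smult (- (\<Sum>k\<in>{j<..n}. a k)) (laguerre \<alpha> j))"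
proof -
  have smult_sum: "(\<Sum>j\<in>J. smult c (f j)) = smult c (\<Sum>j\<in>J. f j)"
    for c :: real and f and J :: "nat set"
    by (induction J rule: infinite_finite_induct) (simp_all add: smult_add_right)
  show ?thesis
  proof (induction n)
    case 0
    show ?case by (simp add: pderiv_smult)
  next
    case (Suc n)
    have "(\<Sum>j<Suc n. smult (- (\<Sum>k\<in>{j<..Suc n}. a k)) (laguerre \<alpha> j))
       = (\<Sum>j<Suc n. smult (- (\<Sum>k\<in>{j<..n}. a k)) (laguerre \<alpha> j) - smult (a (Suc n)) (laguerre \<alpha> j))"
    proof (intro sum.cong refl)
      fix j assume "j \<in> {..<Suc n}"
      then have "{j<..Suc n} = insert (Suc n) {j<..n}" by auto
      then show "smult (- (\<Sum>k\<in>{j<..Suc n}. a k)) (laguerre \<alpha> j) =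
        smult (- (\<Sum>k\<in>{j<..n}. a k)) (laguerre \<alpha> j) - smult (a (Suc n)) (laguerre \<alpha> j)"
        by (simp add: smult_add_left smult_diff_left)
    qed
    also have "\<dots> = (\<Sum>j<n. smult (- (\<Sum>k\<in>{j<..n}. a k)) (laguerre \<alpha> j))
        + smult (a (Suc n)) (pderiv (laguerre \<alpha> (Suc n)))"
      by (simp add: pderiv_laguerre sum_subtractf smult_sum smult_diff_right smult_add_right)
    finally show ?case using Suc by (simp add: pderiv_add pderiv_smult)
  qed
qed

lemma weighted_integral_laguerre_expansion:
  assumes "\<alpha> > -1"
  shows "weighted_integral \<alpha>
           ((\<Sum>k\<le>n. smult (a k) (laguerre \<alpha> k)) * (\<Sum>k\<le>n. smult (a k) (laguerre \<alpha> k)))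
       = (\<Sum>k\<le>n. laguerre_sqnorm \<alpha> k * (a k)\<^sup>2)"
    and "weighted_integral \<alpha>
           (pderiv (\<Sum>k\<le>n. smult (a k) (laguerre \<alpha> k)) *
            pderiv (\<Sum>k\<le>n. smult (a k) (laguerre \<alpha> k)))
       = (\<Sum>j<n. laguerre_sqnorm \<alpha> j * (\<Sum>k\<in>{j<..n}. a k)\<^sup>2)"
  unfolding pderiv_laguerre_expansion weighted_integral_laguerre_sum[OF assms finite_atMost]
    weighted_integral_laguerre_sum[OF assms finite_lessThan]
  by (simp_all add: power2_eq_square mult_ac)

section \<open>A discrete Hardy inequality from a Riccati inequality\<close>

text \<open>
  Jacobi's criterion for a discrete quadratic form. If a positive sequence \<open>u\<close> with ratios
  \<open>u\<^sub>j\<^sub>+\<^sub>1 / u\<^sub>j = 1 - t\<^sub>j\<close> is a supersolution of the Euler-Lagrange equation for the eigenvalue \<open>\<mu>\<close>, then no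
  eigenvalue lies below \<open>\<mu>\<close>. The supersolution property is the Riccati inequality assumed of \<open>t\<close>.
  Each squared difference is bounded below by \<open>s a\<^sup>2 - s / (1 - s) b\<^sup>2\<close>, with equality for \<open>b = (1 - s) a\<close>;
  after summation the assumptions leave at least \<open>\<mu> h\<^sub>j\<close> in front of every \<open>A\<^sub>j\<^sup>2\<close>.
\<close>

lemma discrete_hardy:
  fixes h t A :: "nat \<Rightarrow> real"
  assumes h: "\<And>j. h j > 0"
    and t: "\<And>j. j < n \<Longrightarrow> t j < 1"
    and init: "0 < n \<Longrightarrow> \<mu> * h 0 \<le> h 1 * t 0"
    and step: "\<And>j. Suc j < n \<Longrightarrow> h (Suc j) * (\<mu> + t j / (1 - t j)) \<le> h (Suc (Suc j)) * t (Suc j)"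
    and A: "A n = 0"
  shows "\<mu> * (\<Sum>j<n. h j * (A j)\<^sup>2) \<le> (\<Sum>j<n. h (Suc j) * (A j - A (Suc j))\<^sup>2)"
proof -
  have young: "s * a\<^sup>2 - s / (1 - s) * b\<^sup>2 \<le> (a - b)\<^sup>2" if "s < 1" for s a b :: real
  proof -
    have "(a - b)\<^sup>2 - (s * a\<^sup>2 - s / (1 - s) * b\<^sup>2) = ((1 - s) * a - b)\<^sup>2 / (1 - s)"
      using that by (simp add: divide_simps) (simp add: power2_eq_square algebra_simps)
    also have "\<dots> \<ge> 0" using that by simp
    finally show ?thesis by simp
  qed
  have partial: "\<mu> * (\<Sum>j<Suc m. h j * (A j)\<^sup>2) \<le> (\<Sum>j<Suc m. h (Suc j) * (A j - A (Suc j))\<^sup>2)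
      + h (Suc m) * (t m / (1 - t m)) * (A (Suc m))\<^sup>2" if "m < n" for m
    using that
  proof (induction m)
    case 0
    have "\<mu> * h 0 * (A 0)\<^sup>2 \<le> h 1 * t 0 * (A 0)\<^sup>2"
      using init 0 by (intro mult_right_mono) auto
    moreover have "h 1 * (t 0 * (A 0)\<^sup>2 - t 0 / (1 - t 0) * (A 1)\<^sup>2) \<le> h 1 * (A 0 - A 1)\<^sup>2"
      using young[OF t[OF 0]] h[of 1] by (intro mult_left_mono) auto
    ultimately show ?case by (simp add: algebra_simps)
  next
    case (Suc m)
    let ?k = "Suc m"
    have "h ?k * (\<mu> + t m / (1 - t m)) * (A ?k)\<^sup>2 \<le> h (Suc ?k) * t ?k * (A ?k)\<^sup>2"
      using step[of m] Suc.prems by (intro mult_right_mono) auto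
    moreover have "h (Suc ?k) * (t ?k * (A ?k)\<^sup>2 - t ?k / (1 - t ?k) * (A (Suc ?k))\<^sup>2)
        \<le> h (Suc ?k) * (A ?k - A (Suc ?k))\<^sup>2"
      using young[OF t[OF Suc.prems]] h[of "Suc ?k"] by (intro mult_left_mono) auto
    moreover have "\<mu> * (\<Sum>j<?k. h j * (A j)\<^sup>2) \<le> (\<Sum>j<?k. h (Suc j) * (A j - A (Suc j))\<^sup>2)
      + h ?k * (t m / (1 - t m)) * (A ?k)\<^sup>2"
      using Suc by simp
    ultimately show ?case
      unfolding sum.lessThan_Suc[of _ ?k] by (simp add: algebra_simps)
  qed
  show ?thesis
    using A partial[of "n - 1"] by (cases n) simp_all
qed

section \<open>An explicit solution of the Riccati inequality\<close>

text \<open>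
  Here \<open>M\<close> stands for \<open>(n + 1) (n + \<alpha> + 4)\<close> and \<open>\<mu> = (\<alpha> + 1) (\<alpha> + 8) / (4 M)\<close>. To first order in \<open>\<mu>\<close> the Riccati
  equation has the solution \<open>\<mu> (x + 1) / (\<alpha> + 1)\<close>, which explains the prefactor of \<open>trial\<close>. The remaining factor is
  \<open>(1 - s / 2) / (1 - b s)\<close> with \<open>s = x (x + \<alpha> + 1) / M\<close> and \<open>b = (3 \<alpha> + 14) / (4 (\<alpha> + 3))\<close>, both parts being multiplied
  by \<open>4 (\<alpha> + 3) M\<close>.

  Its shape comes from the regime of large \<open>\<alpha>\<close> and much larger \<open>n\<close>. There the Riccati equation degenerates to
  \<open>G (1 - s G) = 1/4\<close>, that is \<open>G = (1/4) / (1 - s G)\<close>. Two iterations of this fixed point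
  equation, starting from the value \<open>G = 1/2\<close> at \<open>s = 1\<close>, give \<open>(1/4) (1 - s/2) / (1 - 3s/4)\<close>, which is exact at
  \<open>s = 0\<close> and \<open>s = 1\<close>. The correction of \<open>3/4\<close> to \<open>b\<close> reproduces the \<open>x\<^sup>2\<close>-term of the second order expansion in
  \<open>\<mu>\<close>. Finally \<open>s\<close> contains \<open>\<alpha> x\<close> besides \<open>x\<^sup>2\<close> because the denominator \<open>1 - t\<close> of the discrete Riccati inequality cannot
  be neglected when \<open>\<alpha>\<close> is large compared with \<open>n\<close>.
\<close>

definition trial_num :: "real \<Rightarrow> real \<Rightarrow> real \<Rightarrow> real" where
  "trial_num \<alpha> M x = 2 * (\<alpha> + 3) * (2 * M - x * (x + \<alpha> + 1))"

definition trial_den :: "real \<Rightarrow> real \<Rightarrow> real \<Rightarrow> real" where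
  "trial_den \<alpha> M x = trial_num \<alpha> M x - (\<alpha> + 8) * (x * (x + \<alpha> + 1))"

definition trial :: "real \<Rightarrow> real \<Rightarrow> real \<Rightarrow> real" where
  "trial \<alpha> M x = (\<alpha> + 8) * (x + 1) * trial_num \<alpha> M x / (4 * M * trial_den \<alpha> M x)"

text \<open>
  This is \<open>trial < 1\<close> with the denominators cleared. As the bound on \<open>M\<close> is attained for \<open>x = n - 1\<close>, the
  natural variables are the excess \<open>m\<close> of \<open>M\<close> over it and \<open>b = \<alpha> - 2\<close>: in them all coefficients
  are nonnegative.
\<close>

lemma trial_den_bound:
  fixes x \<alpha> M :: real
  assumes "\<alpha> \<ge> 2" "x \<ge> 0" "M \<ge> (x + 2) * (x + \<alpha> + 5)"
  shows "(x + 1) * (\<alpha> + 8) * trial_num \<alpha> M x < 4 * M * trial_den \<alpha> M x"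
proof -
  define m where "m = M - (x + 2) * (x + \<alpha> + 5)"
  define b where "b = \<alpha> - 2"
  have M: "M = (x + 2) * (x + (2 + b) + 5) + m" and m: "m \<ge> 0" and \<alpha>: "\<alpha> = 2 + b" and b: "b \<ge> 0"
    using assms by (simp_all add: m_def b_def)
  have "4 * M * trial_den \<alpha> M x - (x + 1) * (\<alpha> + 8) * trial_num \<alpha> M x =
     (16 * b + 80) * m^2
     + ((20 * b + 80) * x^2
       + (16 * b^2 + 272 * b + 1000) * x
       + 60 * b^2 + 708 * b + 2040) * m
     + 4 * b * x^4
       + (6 * b^2 + 114 * b + 380) * x^3
       + (2 * b^3 + 122 * b^2 + 1312 * b + 3840) * x^2
       + (30 * b^3 + 708 * b^2 + 5258 * b + 12500) * x
       + 56 * b^3 + 1040 * b^2 + 6376 * b + 12880"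
    unfolding trial_den_def trial_num_def \<alpha> M by algebra
  also have "\<dots> > 0"
    using b m assms(2) by (intro add_nonneg_pos add_nonneg_nonneg mult_nonneg_nonneg) simp_all
  finally show ?thesis by simp
qed

text \<open>
  The Riccati inequality for \<open>trial\<close> at \<open>j\<close> after clearing denominators and dividing by the common factor \<open>j (\<alpha> + 8)\<close>.
  It is quadratic in \<open>M\<close>, and in terms of the excess \<open>m\<close> of \<open>M\<close> over its value for \<open>n = j + 1\<close>, the
  least \<open>n\<close> for which the inequality is required, all coefficients are nonnegative.
\<close>

lemma riccati_polynomial_nonneg:
  fixes j \<alpha> M :: real
  assumes "\<alpha> \<ge> 0" "j \<ge> 0" "M \<ge> (j + 2) * (j + \<alpha> + 5)"
  shows "0 \<le> 16 * (\<alpha> + 3) * (2 * j + \<alpha>) * M\<^sup>2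
     + 4 * M * (\<alpha> + 1) * (j + \<alpha> + 1) * trial_den \<alpha> M (j - 1)
     - j * trial_num \<alpha> M (j - 1) * (trial_num \<alpha> M j + (\<alpha> + 1) * (\<alpha> + 8) * (j + \<alpha> + 1))"
    (is "0 \<le> ?G")
proof -
  define m where "m = M - (j + 2) * (j + \<alpha> + 5)"
  have M: "M = (j + 2) * (j + \<alpha> + 5) + m" and m: "m \<ge> 0" using assms(3) by (simp_all add: m_def)
  have "?G =
     (16 * \<alpha>^3 + 96 * \<alpha>^2 + 160 * \<alpha> + 48) * m^2
     + ((4 * \<alpha>^2 + 28 * \<alpha> + 88) * j^3
       + (20 * \<alpha>^3 + 104 * \<alpha>^2 + 212 * \<alpha>) * j^2
       + (16 * \<alpha>^4 + 300 * \<alpha>^3 + 1452 * \<alpha>^2 + 2152 * \<alpha> + 632) * j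
       + 76 * \<alpha>^4 + 784 * \<alpha>^3 + 2684 * \<alpha>^2 + 3448 * \<alpha> + 960) * m
     + (4 * \<alpha> + 52) * j^5
       + (2 * \<alpha>^3 + 40 * \<alpha>^2 + 334 * \<alpha> + 616) * j^4
       + (4 * \<alpha>^4 + 164 * \<alpha>^3 + 956 * \<alpha>^2 + 1912 * \<alpha> + 876) * j^3
       + (2 * \<alpha>^5 + 170 * \<alpha>^4 + 1824 * \<alpha>^3 + 6926 * \<alpha>^2 + 9278 * \<alpha> + 2024) * j^2
       + (42 * \<alpha>^5 + 898 * \<alpha>^4 + 6494 * \<alpha>^3 + 19630 * \<alpha>^2 + 23128 * \<alpha> + 6320) * j
       + 88 * \<alpha>^5 + 1304 * \<alpha>^4 + 7128 * \<alpha>^3 + 17544 * \<alpha>^2 + 18480 * \<alpha> + 4800"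
    unfolding trial_den_def trial_num_def M by algebra
  also have "\<dots> \<ge> 0"
    using assms(1,2) m by (intro add_nonneg_nonneg mult_nonneg_nonneg) simp_all
  finally show ?thesis .
qed

lemma trial_signs:
  fixes x \<alpha> M :: real
  assumes "\<alpha> \<ge> 2" "x \<ge> 0" "M \<ge> (x + 2) * (x + \<alpha> + 5)"
  shows "M > 0" "trial_num \<alpha> M x > 0" "trial_den \<alpha> M x > 0"
proof -
  have x: "0 \<le> x * (x + \<alpha> + 1)" "0 < (x + 2) * (x + \<alpha> + 5) - x * (x + \<alpha> + 1)"
    using assms by (auto simp: algebra_simps intro!: add_nonneg_pos)
  with assms show M: "M > 0" by linarith
  show N: "trial_num \<alpha> M x > 0"
  proof -
    have "0 < 2 * M - x * (x + \<alpha> + 1)" using x assms(3) by linarith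
    then show ?thesis using assms(1) unfolding trial_num_def by (intro mult_pos_pos) auto
  qed
  have "0 < (x + 1) * (\<alpha> + 8) * trial_num \<alpha> M x"
    using assms N by (intro mult_pos_pos) auto
  then have "0 < 4 * M * trial_den \<alpha> M x"
    using trial_den_bound[OF assms] by linarith
  then show "trial_den \<alpha> M x > 0" using M by (simp add: zero_less_mult_iff)
qed

lemma trial_lt_1:
  fixes x \<alpha> M :: real
  assumes "\<alpha> \<ge> 2" "x \<ge> 0" "M \<ge> (x + 2) * (x + \<alpha> + 5)"
  shows "trial \<alpha> M x < 1"
  using trial_den_bound[OF assms] trial_signs[OF assms]
  by (simp add: trial_def mult_ac)

lemma trial_riccati:
  fixes j \<alpha> M :: real
  assumes "\<alpha> \<ge> 2" "j \<ge> 1" "M \<ge> (j + 2) * (j + \<alpha> + 5)"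
  shows "(\<alpha> + 1) * (\<alpha> + 8) / (4 * M) + trial \<alpha> M (j - 1) / (1 - trial \<alpha> M (j - 1))
     \<le> (j + 1 + \<alpha>) / (j + 1) * trial \<alpha> M j"
proof -
  define N D N1 D1 where "N = trial_num \<alpha> M j" and "D = trial_den \<alpha> M j"
    and "N1 = trial_num \<alpha> M (j - 1)" and "D1 = trial_den \<alpha> M (j - 1)"
  define a E where "a = \<alpha> + 8" and "E = 4 * M * D1 - j * a * N1"
  have "(j + 2) * (j + \<alpha> + 5) - (j + 1) * (j + \<alpha> + 4) \<ge> 0"
    using assms by (simp add: algebra_simps)
  with assms have M1: "M \<ge> ((j - 1) + 2) * ((j - 1) + \<alpha> + 5)" by (simp add: add_ac)
  have pos: "M > 0" "D > 0" "D1 > 0" "E > 0" "a > 0"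
    using trial_signs[of \<alpha> j M] trial_signs[OF assms(1) _ M1] trial_den_bound[OF assms(1) _ M1] assms
    by (simp_all add: D_def D1_def N1_def E_def a_def)
  have "trial \<alpha> M (j - 1) / (1 - trial \<alpha> M (j - 1)) = a * j * N1 / E"
  proof -
    have t: "trial \<alpha> M (j - 1) = a * j * N1 / (4 * M * D1)"
      by (simp add: trial_def N1_def D1_def a_def)
    have "1 - trial \<alpha> M (j - 1) = E / (4 * M * D1)"
      using pos by (simp add: t E_def field_simps)
    then show ?thesis using pos unfolding t by simp
  qed
  moreover have "(j + 1 + \<alpha>) / (j + 1) * trial \<alpha> M j = (j + 1 + \<alpha>) * a * N / (4 * M * D)"
    using assms(2) by (simp add: trial_def N_def D_def a_def)
  moreover have "(j + 1 + \<alpha>) * a * N / (4 * M * D) - ((\<alpha> + 1) * a / (4 * M) + a * j * N1 / E) =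
      a * ((j + 1 + \<alpha>) * N * E - (\<alpha> + 1) * D * E - 4 * M * j * N1 * D) / (4 * M * D * E)"
    using pos by (simp add: field_simps)
  moreover have "(j + 1 + \<alpha>) * N * E - (\<alpha> + 1) * D * E - 4 * M * j * N1 * D =
      j * a * (16 * (\<alpha> + 3) * (2 * j + \<alpha>) * M\<^sup>2 + 4 * M * (\<alpha> + 1) * (j + \<alpha> + 1) * D1
        - j * N1 * (N + (\<alpha> + 1) * a * (j + \<alpha> + 1)))"
    unfolding E_def N_def D_def N1_def D1_def a_def trial_den_def trial_num_def by algebra
  moreover have "\<dots> \<ge> 0"
    using riccati_polynomial_nonneg[of \<alpha> j M] assms pos
    by (intro mult_nonneg_nonneg) (simp_all add: N_def D_def N1_def D1_def a_def)
  ultimately show ?thesis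
    using pos by (smt (verit) a_def divide_nonneg_pos mult_nonneg_nonneg mult_pos_pos)
qed

section \<open>The upper bound\<close>

text \<open>
  The coefficients of \<open>p'\<close> are up to sign the tail sums \<open>A\<^sub>j\<close> of those of \<open>p\<close>, whose differences are the coefficients
  of \<open>p\<close> again; the coefficient of \<open>L\<^sub>0\<close> does not enter \<open>p'\<close> and is discarded.
\<close>

lemma markov_inequality_laguerre:
  assumes "\<alpha> \<ge> 2" "degree p \<le> n"
  shows "weighted_integral \<alpha> (pderiv p * pderiv p)
       \<le> 4 * (real n + 1) * (real n + \<alpha> + 4) / ((\<alpha> + 1) * (\<alpha> + 8)) * weighted_integral \<alpha> (p * p)"
proof -
  define M where "M = (real n + 1) * (real n + \<alpha> + 4)"
  define h where "h = laguerre_sqnorm \<alpha>"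
  have \<alpha>: "\<alpha> > -1" using assms(1) by simp
  have M_ge: "M \<ge> (x + 2) * (x + \<alpha> + 5)" if "x \<ge> 0" "x + 1 \<le> real n" for x
    unfolding M_def using that assms(1) by (intro mult_mono) auto
  have h_pos: "h j > 0" for j
    unfolding h_def by (rule laguerre_sqnorm_pos[OF \<alpha>])
  have h_Suc: "h (Suc j) = (real j + 1 + \<alpha>) / (real j + 1) * h j" for j
    using laguerre_sqnorm_Suc[OF \<alpha>, of j] by (simp add: h_def field_simps)
  obtain a where p: "p = (\<Sum>k\<le>n. smult (a k) (laguerre \<alpha> k))"
    using laguerre_expansion[OF assms(2)] by blast
  define A where "A j = (\<Sum>k\<in>{j<..n}. a k)" for j
  have "(\<alpha> + 1) * (\<alpha> + 8) / (4 * M) * (\<Sum>j<n. h j * (A j)\<^sup>2)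
      \<le> (\<Sum>j<n. h (Suc j) * (A j - A (Suc j))\<^sup>2)"
  proof (rule discrete_hardy[where t = "\<lambda>j. trial \<alpha> M (real j)"])
    show "h j > 0" for j by (rule h_pos)
    show "trial \<alpha> M (real j) < 1" if "j < n" for j
      using that by (intro trial_lt_1[OF assms(1)] M_ge) auto
    show "(\<alpha> + 1) * (\<alpha> + 8) / (4 * M) * h 0 \<le> h 1 * trial \<alpha> M (real 0)" if "0 < n"
    proof -
      have M: "M \<ge> (0 + 2) * (0 + \<alpha> + 5)" using that by (intro M_ge) auto
      have "trial_num \<alpha> M 0 = trial_den \<alpha> M 0" by (simp add: trial_den_def)
      then have "trial \<alpha> M 0 = (\<alpha> + 8) / (4 * M)"
        using trial_signs[OF assms(1) order_refl M] by (simp add: trial_def)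
      then show ?thesis using h_Suc[of 0] by (simp add: add.commute mult_ac)
    qed
    show "h (Suc j) * ((\<alpha> + 1) * (\<alpha> + 8) / (4 * M) + trial \<alpha> M (real j) / (1 - trial \<alpha> M (real j)))
        \<le> h (Suc (Suc j)) * trial \<alpha> M (real (Suc j))" if "Suc j < n" for j
    proof -
      have "M \<ge> (real (Suc j) + 2) * (real (Suc j) + \<alpha> + 5)"
        using that by (intro M_ge) auto
      from mult_left_mono[OF trial_riccati[OF assms(1) _ this] less_imp_le[OF h_pos[of "Suc j"]]]
      show ?thesis by (simp add: h_Suc[of "Suc j"] mult_ac)
    qed
    show "A n = 0" by (simp add: A_def)
  qed
  also have "(\<Sum>j<n. h (Suc j) * (A j - A (Suc j))\<^sup>2) = (\<Sum>j<n. h (Suc j) * (a (Suc j))\<^sup>2)"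
  proof (intro sum.cong refl)
    fix j assume "j \<in> {..<n}"
    then have "{j<..n} = insert (Suc j) {Suc j<..n}" by auto
    then show "h (Suc j) * (A j - A (Suc j))\<^sup>2 = h (Suc j) * (a (Suc j))\<^sup>2"
      by (simp add: A_def)
  qed
  also have "\<dots> \<le> (\<Sum>k\<le>n. h k * (a k)\<^sup>2)"
    using h_pos[of 0] by (simp add: sum.atMost_shift)
  finally have "(\<alpha> + 1) * (\<alpha> + 8) / (4 * M) * weighted_integral \<alpha> (pderiv p * pderiv p)
      \<le> weighted_integral \<alpha> (p * p)"
    unfolding p weighted_integral_laguerre_expansion[OF \<alpha>] by (simp add: h_def A_def)
  moreover have "(\<alpha> + 1) * (\<alpha> + 8) > 0" "M > 0"
    unfolding M_def using assms(1) by (intro mult_pos_pos; simp)+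
  ultimately have "weighted_integral \<alpha> (pderiv p * pderiv p)
      \<le> 4 * M / ((\<alpha> + 1) * (\<alpha> + 8)) * weighted_integral \<alpha> (p * p)"
    by (simp add: pos_divide_le_eq pos_le_divide_eq mult_ac)
  then show ?thesis by (simp only: M_def mult.assoc)
qed

section \<open>The lower bound\<close>

text \<open>
  Let \<open>H\<close>, \<open>R\<close> and \<open>Q\<close> be the moments of the square norms about \<open>n\<close> of order zero, one and two. The sum \<open>H\<close> is
  hypergeometric in \<open>n\<close>, with ratio \<open>(n + \<alpha> + 2) / (n + 1)\<close>. Raising \<open>n\<close> by one adds \<open>H\<close> to \<open>R\<close> and \<open>2 R + H\<close> to \<open>Q\<close>,
  which determines first \<open>R\<close> and then \<open>Q\<close> as rational multiples of \<open>H\<close>.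
\<close>

lemma laguerre_sqnorm_sum_squares:
  assumes "\<alpha> > -1"
  shows "(\<alpha> + 2) * (\<alpha> + 3) * (\<Sum>j\<le>n. (real n - real j)\<^sup>2 * laguerre_sqnorm \<alpha> j)
       = real n * (2 * real n + \<alpha> + 1) * (\<Sum>j\<le>n. laguerre_sqnorm \<alpha> j)"
proof -
  define h where "h = laguerre_sqnorm \<alpha>"
  define H R Q where "H n = (\<Sum>j\<le>n. h j)" and "R n = (\<Sum>j\<le>n. (real n - real j) * h j)"
    and "Q n = (\<Sum>j\<le>n. (real n - real j)\<^sup>2 * h j)" for n
  have h: "(real n + 1) * h (Suc n) = (real n + 1 + \<alpha>) * h n" for n
    unfolding h_def by (rule laguerre_sqnorm_Suc[OF assms])
  have H: "(\<alpha> + 1) * H n = (real n + \<alpha> + 1) * h n" for n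
  proof (induction n)
    case (Suc n)
    have "(\<alpha> + 1) * H (Suc n) = (\<alpha> + 1) * H n + (\<alpha> + 1) * h (Suc n)"
      by (simp add: H_def algebra_simps)
    then show ?case using Suc h[of n] by (simp add: algebra_simps)
  qed (simp add: H_def)
  have HS: "(real n + 1) * H (Suc n) = (real n + \<alpha> + 2) * H n" for n
  proof -
    have "(\<alpha> + 1) * ((real n + 1) * H (Suc n)) = (\<alpha> + 1) * ((real n + \<alpha> + 2) * H n)"
      using H[of n] H[of "Suc n"] h[of n] unfolding of_nat_Suc by algebra
    then show ?thesis using assms by simp
  qed
  have RS: "R (Suc n) = R n + H n" for n
    by (simp add: R_def H_def algebra_simps sum.distrib sum_subtractf)
  have R: "(\<alpha> + 2) * R n = real n * H n" for n
  proof (induction n)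
    case (Suc n)
    then show ?case using RS[of n] HS[of n] by (simp add: algebra_simps)
  qed (simp add: R_def)
  have QS: "Q (Suc n) = Q n + 2 * R n + H n" for n
    by (simp add: Q_def R_def H_def algebra_simps power2_eq_square sum.distrib sum_subtractf
        sum_distrib_left)
  have Q: "(\<alpha> + 2) * (\<alpha> + 3) * Q n = real n * (2 * real n + \<alpha> + 1) * H n" for n
  proof (induction n)
    case (Suc n)
    then show ?case using QS[of n] R[of n] HS[of n] unfolding of_nat_Suc by algebra
  qed (simp add: Q_def)
  show ?thesis using Q by (simp add: H_def Q_def h_def)
qed

text \<open>
  The polynomial with all Laguerre coefficients equal to one is the test polynomial for the lower bound: its tail sums
  \<open>n - j\<close> decrease linearly to zero, like a crude version of the extremal sequence, and its quotient is explicit.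
\<close>

lemma laguerre_sum_quotient:
  assumes "\<alpha> > -1"
  defines "p \<equiv> \<lambda>n. \<Sum>k\<le>n. laguerre \<alpha> k"
  shows "weighted_integral \<alpha> (p n * p n) > 0"
    and "weighted_integral \<alpha> (pderiv (p n) * pderiv (p n)) =
      real n * (2 * real n + \<alpha> + 1) / ((\<alpha> + 2) * (\<alpha> + 3)) * weighted_integral \<alpha> (p n * p n)"
proof -
  have p: "p n = (\<Sum>k\<le>n. smult 1 (laguerre \<alpha> k))" by (simp add: p_def)
  have norm: "weighted_integral \<alpha> (p n * p n) = (\<Sum>k\<le>n. laguerre_sqnorm \<alpha> k)"
    unfolding p weighted_integral_laguerre_expansion(1)[OF assms(1)] by simp
  also have "\<dots> > 0" by (intro sum_pos) (auto simp: laguerre_sqnorm_pos[OF assms(1)])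
  finally show "weighted_integral \<alpha> (p n * p n) > 0" .
  have "weighted_integral \<alpha> (pderiv (p n) * pderiv (p n)) =
      (\<Sum>j<n. (real n - real j)\<^sup>2 * laguerre_sqnorm \<alpha> j)"
    unfolding p weighted_integral_laguerre_expansion(2)[OF assms(1)] by (simp add: of_nat_diff mult_ac)
  also have "\<dots> = (\<Sum>j\<le>n. (real n - real j)\<^sup>2 * laguerre_sqnorm \<alpha> j)"
    by (simp flip: lessThan_Suc_atMost)
  finally show "weighted_integral \<alpha> (pderiv (p n) * pderiv (p n)) =
      real n * (2 * real n + \<alpha> + 1) / ((\<alpha> + 2) * (\<alpha> + 3)) * weighted_integral \<alpha> (p n * p n)"
    using laguerre_sqnorm_sum_squares[OF assms(1), of n] assms(1) unfolding norm
    by (simp add: eq_divide_eq mult_ac)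
qed

section \<open>Two-sided bounds for the Markov constant\<close>

theorem corollary1p2:
  fixes \<alpha> :: real and n :: nat
  assumes "\<alpha> \<ge> 2" and "n \<ge> 3"
  shows "(real n + 1) * (real n + \<alpha> + 4) / (2 * (\<alpha> + 1) * (\<alpha> + 8)) \<le> (markov_const n \<alpha>)\<^sup>2
       \<and> (markov_const n \<alpha>)\<^sup>2 \<le> 4 * (real n + 1) * (real n + \<alpha> + 4) / ((\<alpha> + 1) * (\<alpha> + 8))"
proof -
  define lo where "lo = (real n + 1) * (real n + \<alpha> + 4) / (2 * (\<alpha> + 1) * (\<alpha> + 8))"
  define up where "up = 4 * (real n + 1) * (real n + \<alpha> + 4) / ((\<alpha> + 1) * (\<alpha> + 8))"
  define r where "r p = laguerre_norm \<alpha> (poly (pderiv p)) / laguerre_norm \<alpha> (poly p)" for p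
  have \<alpha>: "\<alpha> > -1" using assms(1) by simp
  have up_pos: "up > 0" unfolding up_def using assms(1) by (intro divide_pos_pos mult_pos_pos) auto
  have r: "r p = sqrt (weighted_integral \<alpha> (pderiv p * pderiv p) / weighted_integral \<alpha> (p * p))" for p
    by (simp add: r_def laguerre_norm_poly real_sqrt_divide)
  have r_le: "r p \<le> sqrt up" if "p \<in> polys_upto n - {0}" for p
  proof -
    let ?I = "weighted_integral \<alpha> (pderiv p * pderiv p)" and ?J = "weighted_integral \<alpha> (p * p)"
    have "?I \<le> up * ?J"
      unfolding up_def using that
      by (intro markov_inequality_laguerre[OF assms(1)]) (simp add: polys_upto_def)
    moreover have "?J \<ge> 0"
      unfolding weighted_integral_def set_lebesgue_integral_def
      by (intro Bochner_Integration.integral_nonneg) (simp add: laguerre_weight_def)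
    ultimately have "?I / ?J \<le> up" using up_pos by (cases "?J = 0") (simp_all add: field_simps)
    then show ?thesis unfolding r by simp
  qed
  define p where "p = (\<Sum>k\<le>n. laguerre \<alpha> k)"
  have pp: "weighted_integral \<alpha> (p * p) > 0"
    unfolding p_def by (rule laguerre_sum_quotient(1)[OF \<alpha>])
  then have "p \<noteq> 0" using weighted_integral_smult[of \<alpha> 0 0] by auto
  moreover have "degree p \<le> n"
    unfolding p_def by (intro degree_sum_le) (auto simp: degree_laguerre)
  ultimately have p: "p \<in> polys_upto n - {0}" by (simp add: polys_upto_def)
  have "lo \<le> real n * (2 * real n + \<alpha> + 1) / ((\<alpha> + 2) * (\<alpha> + 3))"
  proof -
    have "(\<alpha> + 2) * (\<alpha> + 3) \<le> (\<alpha> + 1) * (\<alpha> + 8)"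
      using assms(1) by (simp add: algebra_simps)
    moreover have "real n \<ge> 3" using assms(2) by simp
    ultimately have "(real n + 1) * ((\<alpha> + 2) * (\<alpha> + 3)) \<le> (2 * real n) * ((\<alpha> + 1) * (\<alpha> + 8))"
      using assms(1) by (simp add: mult_mono)
    \<comment> \<open>The bound \<open>n \<ge> 3\<close> enters in the comparison of the last factors.\<close>
    then have "((real n + 1) * ((\<alpha> + 2) * (\<alpha> + 3))) * (real n + \<alpha> + 4)
        \<le> ((2 * real n) * ((\<alpha> + 1) * (\<alpha> + 8))) * (2 * real n + \<alpha> + 1)"
      using assms by (simp add: mult_mono)
    then show ?thesis using assms unfolding lo_def
      by (simp add: divide_simps) (simp add: algebra_simps)
  qed
  also have "\<dots> = weighted_integral \<alpha> (pderiv p * pderiv p) / weighted_integral \<alpha> (p * p)"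
    using pp laguerre_sum_quotient(2)[OF \<alpha>, of n] by (simp add: p_def)
  finally have "sqrt lo \<le> r p" unfolding r by simp
  also have "r p \<le> (SUP p \<in> polys_upto n - {0}. r p)"
    using p r_le by (intro cSUP_upper bdd_aboveI2)
  also have "\<dots> = markov_const n \<alpha>"
    by (simp add: markov_const_def r_def)
  finally have lower: "sqrt lo \<le> markov_const n \<alpha>" .
  have "markov_const n \<alpha> = (SUP p \<in> polys_upto n - {0}. r p)"
    by (simp add: markov_const_def r_def)
  also have "\<dots> \<le> sqrt up"
    using p r_le by (intro cSUP_least) auto
  finally have upper: "markov_const n \<alpha> \<le> sqrt up" .
  have lo: "lo \<ge> 0" unfolding lo_def using assms(1) by (intro divide_nonneg_nonneg mult_nonneg_nonneg) auto
  have nonneg: "0 \<le> sqrt lo" using lo by simp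
  have "(sqrt lo)\<^sup>2 \<le> (markov_const n \<alpha>)\<^sup>2"
    using lower nonneg by (rule power_mono)
  moreover have "(markov_const n \<alpha>)\<^sup>2 \<le> (sqrt up)\<^sup>2"
    using upper order_trans[OF nonneg lower] by (rule power_mono)
  ultimately show ?thesis using lo up_pos by (simp add: lo_def up_def)
qed

end
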